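(* Let $m,n\ge 1$ be integers. The number of spanning trees of the complete split graph $S_{m,n}$ is $(m+n)^{m-1}m^{n-1}$ and, consequently, this is also the number of recurrent configurations of the Abelian sandpile model on $S_{m,n}$ (with any chosen vertex of $S_{m,n}$ as the sink).
   Context: The complete split graph $S_{m,n}$ has $m$ clique vertices and $n$ independent vertices. Every two distinct clique vertices are joined by one edge, every clique vertex is joined to every independent vertex by one edge, and no two independent vertices are adjacent. Abelian sandpile model on a graph $G$ with sink $s$: a configuration assigns a non-negative integer (number of grains) to each non-sink vertex. A non-sink vertex $v$ is stable if its number of grains is strictly less than $\deg(v)$, and unstable otherwise. A configuration is stable if all non-sink vertices are stable. An unstable vertex may topple, i.e. it loses $\deg(v)$ grains and gives one grain to each neighbour; grains given to the sink disappear. Toppling unstable vertices eventually leads to a unique stable configuration, the stabilisation. A stable configuration $c$ is recurrent if it can be reached, by adding grains and toppling, from every configuration: for every configuration $d$ there is a configuration $e$ such that the stabilisation of $d+e$ is $c$. *)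

theory Defs
  imports Main
begin

section \<open>Finite simple graphs, given by a vertex set and a set of two-element edges\<close>

definition connected_graph :: "'a set \<Rightarrow> 'a set set \<Rightarrow> bool" where
  "connected_graph V E \<longleftrightarrow> V \<noteq> {} \<and>
     (\<forall>u\<in>V. \<forall>v\<in>V. (u, v) \<in> {(x, y). x \<in> V \<and> y \<in> V \<and> {x, y} \<in> E}\<^sup>*)"

text \<open>A cycle is listed by its vertices, without repeating the first one at the end.\<close>

definition graph_cycle :: "'a set set \<Rightarrow> 'a list \<Rightarrow> bool" where
  "graph_cycle E p \<longleftrightarrow> 3 \<le> length p \<and> distinct p \<and>
     (\<forall>i. Suc i < length p \<longrightarrow> {p ! i, p ! Suc i} \<in> E) \<and> {last p, hd p} \<in> E"

definition tree_graph :: "'a set \<Rightarrow> 'a set set \<Rightarrow> bool" where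
  "tree_graph V E \<longleftrightarrow> connected_graph V E \<and> \<not> (\<exists>p. graph_cycle E p)"

text \<open>A spanning tree has vertex set \<open>V\<close>, so it is identified with its edge set.\<close>

definition spanning_trees :: "'a set \<Rightarrow> 'a set set \<Rightarrow> 'a set set set" where
  "spanning_trees V E = {T. T \<subseteq> E \<and> tree_graph V T}"

definition vertex_degree :: "'a set set \<Rightarrow> 'a \<Rightarrow> nat" where
  "vertex_degree E v = card {e \<in> E. v \<in> e}"

section \<open>The complete split graph\<close>

datatype split_vertex = Clique nat | Indep nat

definition split_verts :: "nat \<Rightarrow> nat \<Rightarrow> split_vertex set" where
  "split_verts m n = Clique ` {..<m} \<union> Indep ` {..<n}"

definition split_edges :: "nat \<Rightarrow> nat \<Rightarrow> split_vertex set set" where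
  "split_edges m n =
     {{Clique i, Clique j} | i j. i < m \<and> j < m \<and> i \<noteq> j} \<union>
     {{Clique i, Indep j} | i j. i < m \<and> j < n}"

section \<open>The Abelian sandpile model on a graph with sink \<open>s\<close>\<close>

text \<open>
  Configurations are functions on the whole type that vanish at the sink and outside \<open>V\<close>, so
  that a configuration is determined by its values on the non-sink vertices.
\<close>

definition configurations :: "'a set \<Rightarrow> 'a \<Rightarrow> ('a \<Rightarrow> nat) set" where
  "configurations V s = {c. \<forall>v. v \<notin> V - {s} \<longrightarrow> c v = 0}"

definition stable_config :: "'a set \<Rightarrow> 'a set set \<Rightarrow> 'a \<Rightarrow> ('a \<Rightarrow> nat) \<Rightarrow> bool" where
  "stable_config V E s c \<longleftrightarrow> c \<in> configurations V s \<and> (\<forall>v \<in> V - {s}. c v < vertex_degree E v)"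

text \<open>
  The subtraction does not truncate where \<open>topple\<close> is used, namely at unstable vertices.
\<close>

definition topple :: "'a set \<Rightarrow> 'a set set \<Rightarrow> 'a \<Rightarrow> 'a \<Rightarrow> ('a \<Rightarrow> nat) \<Rightarrow> 'a \<Rightarrow> nat" where
  "topple V E s v c = (\<lambda>u.
     if u \<notin> V - {s} then 0
     else if u = v then c u - vertex_degree E v
     else if {v, u} \<in> E then c u + 1
     else c u)"

definition topple_step ::
    "'a set \<Rightarrow> 'a set set \<Rightarrow> 'a \<Rightarrow> ('a \<Rightarrow> nat) \<Rightarrow> ('a \<Rightarrow> nat) \<Rightarrow> bool" where
  "topple_step V E s c d \<longleftrightarrow>
     (\<exists>v \<in> V - {s}. vertex_degree E v \<le> c v \<and> d = topple V E s v c)"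

text \<open>
  On a finite connected graph, every configuration has exactly one stabilisation; the definite
  description is meant for that situation only.
\<close>

definition stabilisation :: "'a set \<Rightarrow> 'a set set \<Rightarrow> 'a \<Rightarrow> ('a \<Rightarrow> nat) \<Rightarrow> ('a \<Rightarrow> nat)" where
  "stabilisation V E s c = (THE d. (topple_step V E s)\<^sup>*\<^sup>* c d \<and> stable_config V E s d)"

definition recurrent_config :: "'a set \<Rightarrow> 'a set set \<Rightarrow> 'a \<Rightarrow> ('a \<Rightarrow> nat) \<Rightarrow> bool" where
  "recurrent_config V E s c \<longleftrightarrow> stable_config V E s c \<and>
     (\<forall>d \<in> configurations V s. \<exists>e \<in> configurations V s.
        stabilisation V E s (\<lambda>v. d v + e v) = c)"

end

theory Submission
  imports Defs "HOL-Library.FuncSet" "HOL-Library.Confluence"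
begin

text \<open>
  On every finite connected graph there are as many recurrent configurations as spanning trees,
  because both can be counted by the same recursion. Fix the sink \<open>s\<close>. A spanning tree amounts to a
  map that sends every other vertex to its parent on the way to \<open>s\<close>
  (\<open>card_spanning_trees_eq_card_rooted_forests\<close>). A configuration is recurrent if and only if it is
  stable and has no forbidden subconfiguration, that is, no nonempty set \<open>X\<close> of vertices off the sink
  in which every vertex has fewer grains than neighbours in \<open>X\<close> (\<open>recurrent_config_iff\<close>).

  More generally, let \<open>U\<close> be the set of vertices still to be treated and \<open>L\<close> a set of roots. For
  forests, let \<open>X\<close> be the set of vertices of \<open>U\<close> whose parent is in \<open>L\<close>; for configurations, let \<open>X\<close> be
  the set of vertices that become unstable when all of \<open>L\<close> fires. In both cases every vertex of \<open>X\<close>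
  has as many possible states as it has neighbours in \<open>L\<close>, and what remains is the same problem for
  \<open>U - X\<close> with \<open>X\<close> as the set of roots. So the two numbers agree
  (\<open>card_allowed_configs_eq_card_rooted_forests\<close>).

  For the complete split graph the number of rooted forests depends only on how many clique and
  independent vertices there are in \<open>U\<close> and in \<open>L\<close>, and it has a closed form
  (\<open>card_rooted_forests_split\<close>), which satisfies the recursion by the binomial theorem and its
  derivative.
\<close>

section \<open>A common recursion for rooted forests and for allowed configurations\<close>

definition nbrs :: "'a set set \<Rightarrow> 'a \<Rightarrow> 'a set \<Rightarrow> 'a set" where
  "nbrs E v X = {u \<in> X. {v, u} \<in> E}"

text \<open>
  Forests on \<open>U \<union> L\<close> with root set \<open>L\<close>, given by the map that sends each vertex of \<open>U\<close> to its
  parent. The potential \<open>h\<close> keeps the parents from running in a circle, so that every vertex is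
  eventually led to a root.
\<close>

definition rooted_forests :: "'a set set \<Rightarrow> 'a set \<Rightarrow> 'a set \<Rightarrow> ('a \<Rightarrow> 'a) set" where
  "rooted_forests E U L = {f \<in> extensional U. (\<forall>v\<in>U. f v \<in> nbrs E v (U \<union> L)) \<and>
     (\<exists>h :: 'a \<Rightarrow> nat. \<forall>v\<in>U. f v \<in> U \<longrightarrow> h (f v) < h v)}"

text \<open>
  The stable configurations without forbidden subconfiguration, in the graph induced on \<open>U \<union> L\<close>
  with all of \<open>L\<close> merged into the sink: the threshold of \<open>v\<close> counts its edges to \<open>U\<close> and to \<open>L\<close>.
\<close>

definition allowed_configs :: "'a set set \<Rightarrow> 'a set \<Rightarrow> 'a set \<Rightarrow> ('a \<Rightarrow> nat) set" where
  "allowed_configs E U L = {c \<in> extensional U. (\<forall>v\<in>U. c v < card (nbrs E v (U \<union> L))) \<and>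
     (\<forall>X. X \<subseteq> U \<longrightarrow> X \<noteq> {} \<longrightarrow> (\<exists>v\<in>X. card (nbrs E v X) \<le> c v))}"

lemma allowed_configs_less:
  "c \<in> allowed_configs E U L \<Longrightarrow> v \<in> U \<Longrightarrow> c v < card (nbrs E v (U \<union> L))"
  by (simp add: allowed_configs_def)

lemma allowed_configs_ge:
  assumes "c \<in> allowed_configs E U L" "X \<subseteq> U" "X \<noteq> {}"
  obtains v where "v \<in> X" "card (nbrs E v X) \<le> c v"
  using assms unfolding allowed_configs_def by blast

lemma nbrs_mono: "X \<subseteq> Y \<Longrightarrow> nbrs E v X \<subseteq> nbrs E v Y"
  by (auto simp: nbrs_def)

lemma finite_nbrs [simp]: "finite X \<Longrightarrow> finite (nbrs E v X)"
  by (simp add: nbrs_def)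

lemma card_nbrs_mono: "finite Y \<Longrightarrow> X \<subseteq> Y \<Longrightarrow> card (nbrs E v X) \<le> card (nbrs E v Y)"
  by (intro card_mono nbrs_mono finite_nbrs)

lemma card_nbrs_Un:
  assumes "finite X" "finite Y" "X \<inter> Y = {}"
  shows "card (nbrs E v (X \<union> Y)) = card (nbrs E v X) + card (nbrs E v Y)"
proof -
  have "nbrs E v (X \<union> Y) = nbrs E v X \<union> nbrs E v Y" by (auto simp: nbrs_def)
  then show ?thesis using assms by (simp add: card_Un_disjoint nbrs_def disjoint_iff)
qed

text \<open>
  The counting pattern behind both recursions. Each function in \<open>F\<close> has a first layer \<open>X\<close>; on \<open>X\<close> its
  values are chosen freely, \<open>v\<close> having the options \<open>K X v\<close>, and off \<open>X\<close> it is any member of \<open>G X\<close>.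
  Restricting to \<open>X\<close> and to \<open>U - X\<close> therefore identifies the functions with layer \<open>X\<close> with a product.
\<close>

lemma card_split_by_layer:
  fixes F :: "('a \<Rightarrow> 'b) set" and layer :: "('a \<Rightarrow> 'b) \<Rightarrow> 'a set"
  assumes fin: "finite U" "\<And>X v. X \<subseteq> U \<Longrightarrow> v \<in> X \<Longrightarrow> finite (K X v)" "\<And>X. X \<subseteq> U \<Longrightarrow> finite (G X)"
    and ext: "F \<subseteq> extensional U" "\<And>X. X \<subseteq> U \<Longrightarrow> G X \<subseteq> extensional (U - X)"
    and layer: "\<And>f. f \<in> F \<Longrightarrow> layer f \<in> \<X>" and \<X>: "\<X> \<subseteq> Pow U"
    and split: "\<And>f X. f \<in> extensional U \<Longrightarrow> X \<in> \<X> \<Longrightarrow>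
      f \<in> F \<and> layer f = X \<longleftrightarrow> (\<forall>v\<in>X. f v \<in> K X v) \<and> restrict f (U - X) \<in> G X"
  shows "card F = (\<Sum>X\<in>\<X>. (\<Prod>v\<in>X. card (K X v)) * card (G X))"
proof -
  define FX where "FX X = {f \<in> F. layer f = X}" for X
  have bij: "bij_betw (\<lambda>f. (restrict f X, restrict f (U - X))) (FX X) (PiE X (K X) \<times> G X)"
    if X: "X \<in> \<X>" for X
  proof (rule bij_betw_byWitness[where f' = "\<lambda>(p, q). restrict (\<lambda>v. if v \<in> X then p v else q v) U"])
    have XU: "X \<subseteq> U" using X \<X> by auto
    show "\<forall>f\<in>FX X. (case (restrict f X, restrict f (U - X)) of
        (p, q) \<Rightarrow> restrict (\<lambda>v. if v \<in> X then p v else q v) U) = f"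
      using ext(1) XU by (auto simp: FX_def fun_eq_iff restrict_def extensional_def)
    have gl: "restrict (restrict (\<lambda>v. if v \<in> X then p v else q v) U) X = p"
        "restrict (restrict (\<lambda>v. if v \<in> X then p v else q v) U) (U - X) = q"
      if "p \<in> PiE X (K X)" "q \<in> G X" for p q
    proof -
      have "q \<in> extensional (U - X)" using that ext(2)[OF XU] by auto
      then show "restrict (restrict (\<lambda>v. if v \<in> X then p v else q v) U) X = p"
        "restrict (restrict (\<lambda>v. if v \<in> X then p v else q v) U) (U - X) = q"
        using that(1) XU by (auto simp: fun_eq_iff restrict_def extensional_def PiE_iff)
    qed
    then show "\<forall>x\<in>PiE X (K X) \<times> G X. (\<lambda>f. (restrict f X, restrict f (U - X)))
        (case x of (p, q) \<Rightarrow> restrict (\<lambda>v. if v \<in> X then p v else q v) U) = x"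
      by auto
    show "(\<lambda>f. (restrict f X, restrict f (U - X))) ` FX X \<subseteq> PiE X (K X) \<times> G X"
    proof (rule image_subsetI)
      fix f assume f: "f \<in> FX X"
      then have "f \<in> extensional U" using ext(1) by (auto simp: FX_def)
      then show "(restrict f X, restrict f (U - X)) \<in> PiE X (K X) \<times> G X"
        using split[OF _ X, of f] f by (simp add: FX_def restrict_PiE_iff)
    qed
    show "(\<lambda>(p, q). restrict (\<lambda>v. if v \<in> X then p v else q v) U) ` (PiE X (K X) \<times> G X) \<subseteq> FX X"
    proof clarify
      fix p q assume pq: "p \<in> PiE X (K X)" "q \<in> G X"
      let ?f = "restrict (\<lambda>v. if v \<in> X then p v else q v) U"
      have "(\<forall>v\<in>X. ?f v \<in> K X v) \<and> restrict ?f (U - X) \<in> G X"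
        using gl[OF pq] pq XU by (auto simp: PiE_iff)
      then show "?f \<in> FX X" using split[OF _ X, of ?f] by (auto simp: FX_def)
    qed
  qed
  have finX: "finite \<X>" using \<X> fin(1) by (auto intro: finite_subset)
  have F: "F = (\<Union>X\<in>\<X>. FX X)" using layer by (auto simp: FX_def)
  have finFX: "finite (FX X)" if "X \<in> \<X>" for X
  proof -
    have "finite (PiE X (K X) \<times> G X)"
      using that fin \<X> by (intro finite_cartesian_product finite_PiE) (auto dest: finite_subset)
    then show ?thesis using bij_betw_finite[OF bij[OF that]] by simp
  qed
  have "card F = (\<Sum>X\<in>\<X>. card (FX X))"
    unfolding F using finX finFX by (intro card_UN_disjoint) (auto simp: FX_def)
  also have "\<dots> = (\<Sum>X\<in>\<X>. (\<Prod>v\<in>X. card (K X v)) * card (G X))"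
  proof (rule sum.cong[OF refl])
    fix X assume X: "X \<in> \<X>"
    then have "finite X" using \<X> fin(1) by (auto intro: finite_subset)
    then show "card (FX X) = (\<Prod>v\<in>X. card (K X v)) * card (G X)"
      using bij_betw_same_card[OF bij[OF X]] by (simp add: card_cartesian_product card_PiE)
  qed
  finally show "card F = (\<Sum>X\<in>\<X>. (\<Prod>v\<in>X. card (K X v)) * card (G X))" .
qed

lemma finite_rooted_forests:
  assumes "finite U" "finite L"
  shows "finite (rooted_forests E U L)"
proof (rule finite_subset)
  show "rooted_forests E U L \<subseteq> PiE U (\<lambda>_. U \<union> L)"
    by (simp add: subset_iff rooted_forests_def PiE_iff nbrs_def)
  show "finite (PiE U (\<lambda>_. U \<union> L))" using assms by (simp add: finite_PiE)
qed

lemma finite_allowed_configs: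
  assumes "finite U"
  shows "finite (allowed_configs E U L)"
proof (rule finite_subset)
  show "allowed_configs E U L \<subseteq> PiE U (\<lambda>v. {..<card (nbrs E v (U \<union> L))})"
    by (simp add: subset_iff allowed_configs_def PiE_iff)
  show "finite (PiE U (\<lambda>v. {..<card (nbrs E v (U \<union> L))}))" using assms by (simp add: finite_PiE)
qed

text \<open>
  A vertex of \<open>U\<close> at which the potential is smallest has no possible parent but a root.
\<close>

lemma rooted_forests_no_roots:
  assumes "finite U" "U \<noteq> {}"
  shows "rooted_forests E U {} = {}"
proof -
  have False if f: "f \<in> rooted_forests E U {}" for f
  proof -
    obtain h :: "'a \<Rightarrow> nat" where "\<forall>v\<in>U. f v \<in> U \<longrightarrow> h (f v) < h v"
      and "\<forall>v\<in>U. f v \<in> nbrs E v U"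
      using f by (auto simp: rooted_forests_def)
    then have h: "\<And>v. v \<in> U \<Longrightarrow> f v \<in> U \<and> h (f v) < h v" by (simp add: nbrs_def)
    obtain v where "v \<in> U" "\<And>u. u \<in> U \<Longrightarrow> h v \<le> h u"
      using assms ex_min_if_finite[of "h ` U"] by (auto simp: not_less)
    then show False using h by (metis not_less)
  qed
  then show ?thesis by auto
qed

lemma rooted_forests_empty: "rooted_forests E {} L = {\<lambda>_. undefined}"
  by (auto simp: rooted_forests_def)

lemma allowed_configs_empty: "allowed_configs E {} L = {\<lambda>_. undefined}"
  by (auto simp: allowed_configs_def)

text \<open>
  The first layer consists of the vertices whose parent is a root. Each of them chooses any
  neighbour in \<open>L\<close>; the other vertices form a forest whose roots are the first layer, since none of
  them is attached to \<open>L\<close> directly.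
\<close>

lemma card_rooted_forests_rec:
  assumes fin: "finite U" "finite L" and ne: "U \<noteq> {}" and disj: "U \<inter> L = {}"
  shows "card (rooted_forests E U L) =
    (\<Sum>X\<in>Pow U - {{}}. (\<Prod>v\<in>X. card (nbrs E v L)) * card (rooted_forests E (U - X) X))"
proof (rule card_split_by_layer[where layer = "\<lambda>f. {v \<in> U. f v \<in> L}"
      and K = "\<lambda>X v. nbrs E v L" and G = "\<lambda>X. rooted_forests E (U - X) X"])
  show "finite U" by fact
  show "finite (nbrs E v L)" for v by (simp add: fin)
  show "finite (rooted_forests E (U - X) X)" if "X \<subseteq> U" for X
    using that fin by (intro finite_rooted_forests) (auto intro: finite_subset)
  show "rooted_forests E U L \<subseteq> extensional U" by (auto simp: rooted_forests_def)
  show "rooted_forests E (U - X) X \<subseteq> extensional (U - X)" for X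
    by (auto simp: rooted_forests_def)
  show "Pow U - {{}} \<subseteq> Pow U" by auto
  show "{v \<in> U. f v \<in> L} \<in> Pow U - {{}}" if f: "f \<in> rooted_forests E U L" for f
  proof -
    have False if "{v \<in> U. f v \<in> L} = {}"
    proof -
      have "f \<in> rooted_forests E U {}"
        using f that by (auto simp: rooted_forests_def nbrs_def)
      then show False using rooted_forests_no_roots[OF fin(1) ne] by auto
    qed
    then show ?thesis by auto
  qed
  show "f \<in> rooted_forests E U L \<and> {v \<in> U. f v \<in> L} = X \<longleftrightarrow>
      (\<forall>v\<in>X. f v \<in> nbrs E v L) \<and> restrict f (U - X) \<in> rooted_forests E (U - X) X"
    if ext: "f \<in> extensional U" and "X \<in> Pow U - {{}}" for f X
  proof (intro iffI conjI)
    have X: "X \<subseteq> U" using that by auto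
    {
      assume A: "f \<in> rooted_forests E U L \<and> {v \<in> U. f v \<in> L} = X"
      then show "\<forall>v\<in>X. f v \<in> nbrs E v L" by (auto simp: rooted_forests_def nbrs_def)
      show "restrict f (U - X) \<in> rooted_forests E (U - X) X"
        using A by (auto simp: rooted_forests_def nbrs_def)
    next
      assume A: "(\<forall>v\<in>X. f v \<in> nbrs E v L) \<and> restrict f (U - X) \<in> rooted_forests E (U - X) X"
      then have XL: "\<And>v. v \<in> X \<Longrightarrow> f v \<in> L" by (auto simp: nbrs_def)
      have "\<exists>h :: 'a \<Rightarrow> nat. \<forall>v\<in>U - X. restrict f (U - X) v \<in> U - X \<longrightarrow>
          h (restrict f (U - X) v) < h v"
        using A unfolding rooted_forests_def by blast
      then obtain h :: "'a \<Rightarrow> nat" where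
        h: "\<And>v. v \<in> U - X \<Longrightarrow> f v \<in> U - X \<Longrightarrow> h (f v) < h v"
        by auto
      have fv: "f v \<in> nbrs E v U" if "v \<in> U - X" for v
      proof -
        have "restrict f (U - X) v \<in> nbrs E v (U - X \<union> X)"
          using A that unfolding rooted_forests_def by blast
        then show ?thesis using that X by (auto simp: nbrs_def)
      qed
      \<comment> \<open>The potential of the smaller forest is raised by one to make room for its roots below it.\<close>
      define h' where "h' v = (if v \<in> X then 0 else Suc (h v))" for v
      have "\<forall>v\<in>U. f v \<in> U \<longrightarrow> h' (f v) < h' v"
        using h XL disj by (auto simp: h'_def)
      moreover have "\<forall>v\<in>U. f v \<in> nbrs E v (U \<union> L)"
        using A fv by (auto simp: nbrs_def)
      ultimately show "f \<in> rooted_forests E U L" using ext by (auto simp: rooted_forests_def)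
      show "{v \<in> U. f v \<in> L} = X"
        using XL X fv disj by (auto simp: nbrs_def)
    }
  qed
qed

text \<open>
  The first layer consists of the vertices that become unstable once every vertex of \<open>L\<close> has fired,
  that is, those with at least as many grains as neighbours in \<open>U\<close>; it is nonempty because \<open>U\<close>
  itself is not forbidden. On it the number of grains lies in a window as wide as the number of
  neighbours in \<open>L\<close>. The other vertices have fewer grains than neighbours in \<open>U\<close>, which is stability
  for the same problem with the first layer as the new roots. A subset of \<open>U\<close> that meets the first
  layer is never forbidden, so only the subsets of the remainder matter.
\<close>

lemma card_allowed_configs_rec:
  assumes fin: "finite U" "finite L" and ne: "U \<noteq> {}" and disj: "U \<inter> L = {}"
  shows "card (allowed_configs E U L) =
    (\<Sum>X\<in>Pow U - {{}}. (\<Prod>v\<in>X. card (nbrs E v L)) * card (allowed_configs E (U - X) X))"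
proof -
  let ?K = "\<lambda>v. {card (nbrs E v U)..<card (nbrs E v U) + card (nbrs E v L)}"
  note cUn = card_nbrs_Un[OF fin disj]
  have "card (allowed_configs E U L) =
    (\<Sum>X\<in>Pow U - {{}}. (\<Prod>v\<in>X. card (?K v)) * card (allowed_configs E (U - X) X))"
  proof (rule card_split_by_layer[where layer = "\<lambda>c. {v \<in> U. card (nbrs E v U) \<le> c v}"])
    show "finite U" by fact
    show "finite (?K v)" for v by simp
    show "finite (allowed_configs E (U - X) X)" for X
      using fin by (intro finite_allowed_configs) auto
    show "allowed_configs E U L \<subseteq> extensional U" by (auto simp: allowed_configs_def)
    show "allowed_configs E (U - X) X \<subseteq> extensional (U - X)" for X
      by (auto simp: allowed_configs_def)
    show "Pow U - {{}} \<subseteq> Pow U" by auto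
    show "{v \<in> U. card (nbrs E v U) \<le> f v} \<in> Pow U - {{}}" if "f \<in> allowed_configs E U L" for f
      using that ne by (auto simp: allowed_configs_def)
    show "f \<in> allowed_configs E U L \<and> {v \<in> U. card (nbrs E v U) \<le> f v} = X \<longleftrightarrow>
        (\<forall>v\<in>X. f v \<in> ?K v) \<and> restrict f (U - X) \<in> allowed_configs E (U - X) X"
      if ext: "f \<in> extensional U" and "X \<in> Pow U - {{}}" for f X
    proof (intro iffI conjI)
      have X: "X \<subseteq> U" using that by auto
      then have UX: "U - X \<union> X = U" by auto
      {
        assume A: "f \<in> allowed_configs E U L \<and> {v \<in> U. card (nbrs E v U) \<le> f v} = X"
        then show "\<forall>v\<in>X. f v \<in> ?K v" by (auto simp: allowed_configs_def cUn)
        have "\<exists>v\<in>Y. card (nbrs E v Y) \<le> restrict f (U - X) v" if Y: "Y \<subseteq> U - X" "Y \<noteq> {}" for Y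
        proof -
          have "Y \<subseteq> U" using Y by auto
          then obtain v where v: "v \<in> Y" "card (nbrs E v Y) \<le> f v"
            using A Y(2) by (blast elim: allowed_configs_ge)
          then show ?thesis using Y(1) by (intro bexI[OF _ v(1)]) auto
        qed
        moreover have "restrict f (U - X) v < card (nbrs E v (U - X \<union> X))" if "v \<in> U - X" for v
        proof -
          have "v \<notin> {v \<in> U. card (nbrs E v U) \<le> f v}" using A that by blast
          then show ?thesis using that unfolding UX by simp
        qed
        ultimately show "restrict f (U - X) \<in> allowed_configs E (U - X) X"
          unfolding allowed_configs_def by simp
      next
        assume A: "(\<forall>v\<in>X. f v \<in> ?K v) \<and> restrict f (U - X) \<in> allowed_configs E (U - X) X"
        have low: "\<And>v. v \<in> U - X \<Longrightarrow> f v < card (nbrs E v U)"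
          using A allowed_configs_less[of "restrict f (U - X)" E "U - X" X] X
          by (simp add: Un_absorb2)
        have "\<exists>v\<in>Y. card (nbrs E v Y) \<le> f v" if Y: "Y \<subseteq> U" "Y \<noteq> {}" for Y
        proof (cases "Y \<inter> X = {}")
          case True
          then have "Y \<subseteq> U - X" using Y by auto
          then obtain v where "v \<in> Y" "card (nbrs E v Y) \<le> restrict f (U - X) v"
            using A Y(2) by (blast elim: allowed_configs_ge)
          then show ?thesis using \<open>Y \<subseteq> U - X\<close> by (intro bexI[of _ v]) auto
        next
          case False
          then obtain v where v: "v \<in> Y" "v \<in> X" by auto
          have "card (nbrs E v Y) \<le> card (nbrs E v U)" using Y fin by (intro card_nbrs_mono)
          also have "\<dots> \<le> f v" using A v by auto
          finally show ?thesis using v by auto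
        qed
        moreover have "\<forall>v\<in>U. f v < card (nbrs E v (U \<union> L))"
        proof
          fix v assume "v \<in> U"
          then show "f v < card (nbrs E v (U \<union> L))"
            using A low[of v] by (cases "v \<in> X") (auto simp: cUn)
        qed
        ultimately show "f \<in> allowed_configs E U L" using ext by (auto simp: allowed_configs_def)
        show "{v \<in> U. card (nbrs E v U) \<le> f v} = X"
        proof (intro set_eqI iffI)
          fix v assume "v \<in> {v \<in> U. card (nbrs E v U) \<le> f v}"
          then show "v \<in> X" using low[of v] by (cases "v \<in> X") auto
        next
          fix v assume "v \<in> X"
          then show "v \<in> {v \<in> U. card (nbrs E v U) \<le> f v}" using A X by auto
        qed
      }
    qed
  qed
  then show ?thesis by simp
qed

theorem card_allowed_configs_eq_card_rooted_forests:
  assumes "finite U" "finite L" "U \<inter> L = {}"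
  shows "card (allowed_configs E U L) = card (rooted_forests E U L)"
  using assms
proof (induction "card U" arbitrary: U L rule: less_induct)
  case less
  show ?case
  proof (cases "U = {}")
    case True
    then show ?thesis by (simp add: rooted_forests_empty allowed_configs_empty)
  next
    case False
    have "card (allowed_configs E (U - X) X) = card (rooted_forests E (U - X) X)"
      if "X \<in> Pow U - {{}}" for X
    proof (rule less.hyps)
      show "card (U - X) < card U" using that less.prems(1) by (intro psubset_card_mono) auto
    qed (use that less.prems(1) in \<open>auto intro: finite_subset\<close>)
    then show ?thesis
      by (simp add: card_allowed_configs_rec card_rooted_forests_rec False less.prems)
  qed
qed

section \<open>Spanning trees are parent maps\<close>

text \<open>
  The distance to \<open>s\<close> is such a potential. It orients the edges towards \<open>s\<close> and serves both to read
  off the parents in a tree and to build a superharmonic function for the sandpile model.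
\<close>

lemma connected_graph_descent:
  assumes conn: "connected_graph V E" and s: "s \<in> V"
  shows "\<exists>h :: 'a \<Rightarrow> nat. h s = 0 \<and> (\<forall>v\<in>V - {s}. \<exists>u\<in>V. {v, u} \<in> E \<and> h u < h v)"
proof -
  let ?R = "{(x, y). x \<in> V \<and> y \<in> V \<and> {x, y} \<in> E}"
  define h where "h v = (LEAST n. (v, s) \<in> ?R ^^ n)" for v
  have "h s = 0" unfolding h_def by (rule Least_eq_0) simp
  moreover have "\<exists>u\<in>V. {v, u} \<in> E \<and> h u < h v" if v: "v \<in> V - {s}" for v
  proof -
    have "(v, s) \<in> ?R\<^sup>*" using conn s v by (auto simp: connected_graph_def)
    then obtain n where "(v, s) \<in> ?R ^^ n" by (auto dest: rtrancl_imp_relpow)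
    then have hv: "(v, s) \<in> ?R ^^ h v" unfolding h_def by (rule LeastI)
    have "h v \<noteq> 0" using hv v by (intro notI) auto
    then obtain k where k: "h v = Suc k" by (cases "h v") auto
    then have "(v, s) \<in> ?R ^^ Suc k" using hv by simp
    from relpow_Suc_D2[OF this] obtain u where u: "(v, u) \<in> ?R" "(u, s) \<in> ?R ^^ k" by blast
    then have "h u \<le> k" unfolding h_def by (intro Least_le)
    then show ?thesis using u k by auto
  qed
  ultimately show ?thesis by blast
qed

lemma rtrancl_distinct_path:
  assumes "(x, y) \<in> R\<^sup>*"
  shows "\<exists>p. p \<noteq> [] \<and> hd p = x \<and> last p = y \<and> distinct p \<and> successively (\<lambda>a b. (a, b) \<in> R) p"
  using assms
proof (induction rule: converse_rtrancl_induct)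
  case base
  then show ?case by (intro exI[of _ "[y]"]) simp
next
  case (step x z)
  then obtain p where p: "p \<noteq> []" "hd p = z" "last p = y" "distinct p"
    "successively (\<lambda>a b. (a, b) \<in> R) p" by blast
  show ?case
  proof (cases "x \<in> set p")
    case True
    then obtain a b where "p = a @ x # b" by (auto simp: in_set_conv_decomp)
    then show ?thesis using p
      by (intro exI[of _ "x # b"]) (auto simp: successively_append_iff)
  next
    case False
    then show ?thesis using p step.hyps
      by (intro exI[of _ "x # p"]) (auto simp: successively_Cons)
  qed
qed

text \<open>
  An edge that joins the ends of a path avoiding it closes a cycle; the path has at least three
  vertices exactly because it avoids the edge.
\<close>

lemma graph_cycle_if_path:
  assumes "(x, y) \<in> {(a, b). {a, b} \<in> T}\<^sup>*" "{x, y} \<notin> T" "x \<noteq> y" "T \<subseteq> T'" "{x, y} \<in> T'"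
  shows "\<exists>p. graph_cycle T' p"
proof -
  obtain p where p: "p \<noteq> []" "hd p = x" "last p = y" "distinct p"
    "successively (\<lambda>a b. {a, b} \<in> T) p"
    using rtrancl_distinct_path[OF assms(1)] by auto
  have "3 \<le> length p"
  proof (rule ccontr)
    assume "\<not> 3 \<le> length p"
    then have "length p = 1 \<or> length p = 2" using p(1) by (cases p) (auto simp: numeral_2_eq_2 not_le less_Suc_eq)
    then show False using p assms(2,3)
      by (auto simp: length_Suc_conv numeral_2_eq_2)
  qed
  moreover have "{p ! i, p ! Suc i} \<in> T'" if "Suc i < length p" for i
    using p(5) that assms(4) by (auto simp: successively_conv_nth)
  ultimately show ?thesis
    using p assms(5) by (auto simp: graph_cycle_def insert_commute)
qed

text \<open>
  At a vertex of maximal height on a cycle, both neighbours on the cycle would have to be its parent,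
  although they are distinct.
\<close>

lemma no_cycle_if_parent_map:
  fixes h :: "'a \<Rightarrow> nat"
  assumes T: "\<And>x y. {x, y} \<in> T \<Longrightarrow> (y = f x \<and> h y < h x) \<or> (x = f y \<and> h x < h y)"
  shows "\<not> graph_cycle T p"
proof
  assume p: "graph_cycle T p"
  then have len: "3 \<le> length p" and dist: "distinct p" by (auto simp: graph_cycle_def)
  then have "p \<noteq> []" by auto
  obtain i where i: "i < length p" and max: "\<And>j. j < length p \<Longrightarrow> h (p ! j) \<le> h (p ! i)"
  proof -
    have "Max ((\<lambda>j. h (p ! j)) ` {..<length p}) \<in> (\<lambda>j. h (p ! j)) ` {..<length p}"
      using \<open>p \<noteq> []\<close> by (intro Max_in) auto
    then obtain i where "i < length p" "Max ((\<lambda>j. h (p ! j)) ` {..<length p}) = h (p ! i)" by auto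
    then show thesis using that by (metis Max_ge finite_imageI finite_lessThan imageI lessThan_iff)
  qed
  define next_i prev_i where "next_i = (if Suc i < length p then Suc i else 0)"
    and "prev_i = (if i = 0 then length p - 1 else i - 1)"
  have lt: "next_i < length p" "prev_i < length p" and ne: "next_i \<noteq> prev_i"
    using i len by (auto simp: next_i_def prev_i_def)
  have E: "{p ! j, p ! Suc j} \<in> T" if "Suc j < length p" for j
    using p that by (simp add: graph_cycle_def)
  have E0: "{p ! (length p - 1), p ! 0} \<in> T"
    using p \<open>p \<noteq> []\<close> by (simp add: graph_cycle_def last_conv_nth hd_conv_nth)
  have "{p ! i, p ! next_i} \<in> T"
  proof (cases "Suc i < length p")
    case False
    then have "i = length p - 1" using i by auto
    then show ?thesis using E0 False by (simp add: next_i_def)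
  qed (use E in \<open>simp add: next_i_def\<close>)
  moreover have "{p ! i, p ! prev_i} \<in> T"
  proof (cases "i = 0")
    case False
    then show ?thesis using E[of "i - 1"] i by (simp add: prev_i_def insert_commute)
  qed (use E0 in \<open>simp add: prev_i_def insert_commute\<close>)
  ultimately have "p ! next_i = f (p ! i)" "p ! prev_i = f (p ! i)"
    using T[of "p ! i"] max[OF lt(1)] max[OF lt(2)] by (fastforce simp: not_less)+
  then show False using dist lt ne by (metis nth_eq_iff_index_eq)
qed

lemma connected_graph_if_descent:
  fixes h :: "'a \<Rightarrow> nat"
  assumes s: "s \<in> V" and desc: "\<And>v. v \<in> V - {s} \<Longrightarrow> \<exists>u\<in>V. {v, u} \<in> T \<and> h u < h v"
  shows "connected_graph V T"
proof -
  let ?R = "{(x, y). x \<in> V \<and> y \<in> V \<and> {x, y} \<in> T}"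
  have to_s: "(v, s) \<in> ?R\<^sup>*" if "v \<in> V" for v
    using that
  proof (induction "h v" arbitrary: v rule: less_induct)
    case less
    show ?case
    proof (cases "v = s")
      case False
      then obtain u where u: "u \<in> V" "{v, u} \<in> T" "h u < h v" using desc less.prems by auto
      then have "(v, u) \<in> ?R" using less.prems by auto
      then show ?thesis using less.hyps[OF u(3) u(1)] by (rule converse_rtrancl_into_rtrancl)
    qed simp
  qed
  have "sym ?R" by (auto simp: sym_def insert_commute)
  then have from_s: "(s, v) \<in> ?R\<^sup>*" if "v \<in> V" for v
    using to_s[OF that] by (rule symD[OF sym_rtrancl])
  show ?thesis unfolding connected_graph_def
  proof (intro conjI ballI)
    show "V \<noteq> {}" using s by auto
    show "(u, v) \<in> ?R\<^sup>*" if "u \<in> V" "v \<in> V" for u v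
      using to_s[OF that(1)] from_s[OF that(2)] by (rule rtrancl_trans)
  qed
qed

definition parent_edges :: "'a set \<Rightarrow> ('a \<Rightarrow> 'a) \<Rightarrow> 'a set set" where
  "parent_edges U f = (\<lambda>v. {v, f v}) ` U"

text \<open>
  Giving the sink height zero and raising all other heights makes the height drop at every step,
  also at the last one, into the sink.
\<close>

lemma rooted_forest_heights:
  assumes f: "f \<in> rooted_forests E (V - {s}) {s}" and s: "s \<in> V"
  shows "\<exists>h :: 'a \<Rightarrow> nat. \<forall>v\<in>V - {s}. f v \<in> V \<and> {v, f v} \<in> E \<and> h (f v) < h v"
proof -
  obtain h :: "'a \<Rightarrow> nat" where h: "\<forall>v\<in>V - {s}. f v \<in> V - {s} \<longrightarrow> h (f v) < h v"
    using f by (auto simp: rooted_forests_def)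
  have fv: "\<forall>v\<in>V - {s}. f v \<in> nbrs E v (V - {s} \<union> {s})"
    using f by (simp add: rooted_forests_def)
  show ?thesis
  proof (intro exI[of _ "\<lambda>v. if v = s then 0 else Suc (h v)"] ballI)
    fix v assume v: "v \<in> V - {s}"
    then have "f v \<in> nbrs E v (V - {s} \<union> {s})" using fv by blast
    then have "f v \<in> V" "{v, f v} \<in> E" using s by (auto simp: nbrs_def)
    moreover have "f v \<noteq> s \<Longrightarrow> h (f v) < h v" using h v \<open>f v \<in> V\<close> by blast
    ultimately show "f v \<in> V \<and> {v, f v} \<in> E \<and>
        (if f v = s then 0 else Suc (h (f v))) < (if v = s then 0 else Suc (h v))"
      using v by auto
  qed
qed

text \<open>
  Suppose that two parent maps with the same edges differ at \<open>v\<close>. The edge from \<open>v\<close> to its first parent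
  \<open>w\<close> must arise in the second map as the edge from \<open>w\<close> to \<open>v\<close>. So the maps differ at \<open>w\<close> as well, which is
  lower than \<open>v\<close>: induction on the height excludes this.
\<close>

lemma inj_on_parent_edges:
  assumes s: "s \<in> V"
  shows "inj_on (parent_edges (V - {s})) (rooted_forests E (V - {s}) {s})"
proof (rule inj_onI)
  fix f g assume f: "f \<in> rooted_forests E (V - {s}) {s}" and g: "g \<in> rooted_forests E (V - {s}) {s}"
    and eq: "parent_edges (V - {s}) f = parent_edges (V - {s}) g"
  obtain h :: "'a \<Rightarrow> nat" where h: "\<And>v. v \<in> V - {s} \<Longrightarrow> f v \<in> V \<and> {v, f v} \<in> E \<and> h (f v) < h v"
    using rooted_forest_heights[OF f s] by blast
  have "f v = g v" if "v \<in> V - {s}" for v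
    using that
  proof (induction "h v" arbitrary: v rule: less_induct)
    case less
    show ?case
    proof (rule ccontr)
      assume ne: "f v \<noteq> g v"
      have "{v, f v} \<in> parent_edges (V - {s}) g"
        using less.prems eq[symmetric] by (auto simp: parent_edges_def)
      then obtain w where w: "w \<in> V - {s}" "{v, f v} = {w, g w}" by (auto simp: parent_edges_def)
      then have "w = f v" "g w = v" using ne by (auto simp: doubleton_eq_iff)
      moreover have "h (f v) < h v" using h less.prems by blast
      ultimately have "f w = v" using less.hyps[of w] w by auto
      then have "h v < h w" using h[of w] w by auto
      then show False using \<open>h (f v) < h v\<close> \<open>w = f v\<close> by simp
    qed
  qed
  moreover have "f \<in> extensional (V - {s})" "g \<in> extensional (V - {s})"
    using f g by (simp_all add: rooted_forests_def)
  ultimately show "f = g" by (intro extensionalityI)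
qed

lemma spanning_tree_parent_edges:
  assumes s: "s \<in> V" and f: "f \<in> rooted_forests E (V - {s}) {s}"
  shows "parent_edges (V - {s}) f \<in> spanning_trees V E"
proof -
  obtain h :: "'a \<Rightarrow> nat" where h: "\<And>v. v \<in> V - {s} \<Longrightarrow> f v \<in> V \<and> {v, f v} \<in> E \<and> h (f v) < h v"
    using rooted_forest_heights[OF f s] by blast
  have "connected_graph V (parent_edges (V - {s}) f)"
    using s h by (intro connected_graph_if_descent[where h = h]) (auto simp: parent_edges_def)
  moreover have "\<not> graph_cycle (parent_edges (V - {s}) f) p" for p
    using h by (intro no_cycle_if_parent_map[where f = f and h = h])
      (auto simp: parent_edges_def doubleton_eq_iff)
  moreover have "parent_edges (V - {s}) f \<subseteq> E" using h by (auto simp: parent_edges_def)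
  ultimately show ?thesis by (auto simp: spanning_trees_def tree_graph_def)
qed

text \<open>
  In a tree, let each vertex choose a neighbour closer to \<open>s\<close>. The chosen edges already connect the
  graph, so any edge left over would close a cycle.
\<close>

lemma spanning_tree_is_parent_edges:
  assumes s: "s \<in> V" and edges: "\<And>e. e \<in> E \<Longrightarrow> \<exists>u v. e = {u, v} \<and> u \<noteq> v \<and> u \<in> V \<and> v \<in> V"
    and T: "T \<in> spanning_trees V E"
  shows "T \<in> parent_edges (V - {s}) ` rooted_forests E (V - {s}) {s}"
proof -
  have conn: "connected_graph V T" and acyc: "\<And>p. \<not> graph_cycle T p" and TE: "T \<subseteq> E"
    using T by (auto simp: spanning_trees_def tree_graph_def)
  obtain h :: "'a \<Rightarrow> nat" where h: "h s = 0"
    "\<And>v. v \<in> V - {s} \<Longrightarrow> \<exists>u\<in>V. {v, u} \<in> T \<and> h u < h v"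
    using connected_graph_descent[OF conn s] by blast
  then have "\<forall>v\<in>V - {s}. \<exists>u. u \<in> V \<and> {v, u} \<in> T \<and> h u < h v" by blast
  from bchoice[OF this] obtain g
    where g: "\<And>v. v \<in> V - {s} \<Longrightarrow> g v \<in> V \<and> {v, g v} \<in> T \<and> h (g v) < h v" by blast
  define f where "f = restrict g (V - {s})"
  have f: "f v \<in> V \<and> {v, f v} \<in> T \<and> h (f v) < h v" if "v \<in> V - {s}" for v
    using g that by (simp add: f_def)
  have "f \<in> rooted_forests E (V - {s}) {s}"
    unfolding rooted_forests_def
  proof (intro CollectI conjI exI[of _ h])
    show "f \<in> extensional (V - {s})" by (simp add: f_def)
  qed (use f TE in \<open>auto simp: nbrs_def\<close>)
  moreover have "T = parent_edges (V - {s}) f"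
  proof (rule ccontr)
    assume ne: "T \<noteq> parent_edges (V - {s}) f"
    have sub: "parent_edges (V - {s}) f \<subseteq> T" using f by (auto simp: parent_edges_def)
    then obtain e where e: "e \<in> T" "e \<notin> parent_edges (V - {s}) f" using ne by auto
    then obtain x y where xy: "e = {x, y}" "x \<noteq> y" "x \<in> V" "y \<in> V"
      using edges TE by blast
    have "connected_graph V (parent_edges (V - {s}) f)"
      using s f by (intro connected_graph_if_descent[where h = h]) (auto simp: parent_edges_def)
    then have "(x, y) \<in> {(a, b). a \<in> V \<and> b \<in> V \<and> {a, b} \<in> parent_edges (V - {s}) f}\<^sup>*"
      using xy by (auto simp: connected_graph_def)
    then have "(x, y) \<in> {(a, b). {a, b} \<in> parent_edges (V - {s}) f}\<^sup>*"
      by (rule rtrancl_mono[THEN subsetD, rotated]) auto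
    from graph_cycle_if_path[OF this _ xy(2) sub] show False using e xy(1) acyc by simp
  qed
  ultimately show ?thesis by blast
qed

theorem card_spanning_trees_eq_card_rooted_forests:
  assumes "s \<in> V" "\<And>e. e \<in> E \<Longrightarrow> \<exists>u v. e = {u, v} \<and> u \<noteq> v \<and> u \<in> V \<and> v \<in> V"
  shows "card (spanning_trees V E) = card (rooted_forests E (V - {s}) {s})"
proof -
  have "spanning_trees V E = parent_edges (V - {s}) ` rooted_forests E (V - {s}) {s}"
    using spanning_tree_parent_edges[OF assms(1)] spanning_tree_is_parent_edges[OF assms] by blast
  then show ?thesis by (simp add: card_image inj_on_parent_edges assms(1))
qed

section \<open>Recurrent configurations have no forbidden subconfiguration\<close>

locale sandpile_graph =
  fixes V :: "'a set" and E :: "'a set set" and s :: 'a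
  assumes finite_V: "finite V" and sink: "s \<in> V"
    and edges: "e \<in> E \<Longrightarrow> \<exists>u v. e = {u, v} \<and> u \<noteq> v \<and> u \<in> V \<and> v \<in> V"
    and connected: "connected_graph V E"
begin

lemma edgeD: "{v, u} \<in> E \<Longrightarrow> v \<noteq> u \<and> v \<in> V \<and> u \<in> V"
  using edges[of "{v, u}"] by (auto simp: doubleton_eq_iff)

lemma vertex_degree_eq: "vertex_degree E v = card (nbrs E v V)"
proof -
  have "{e \<in> E. v \<in> e} = (\<lambda>u. {v, u}) ` nbrs E v V"
  proof (intro set_eqI iffI)
    fix e assume e: "e \<in> {e \<in> E. v \<in> e}"
    then obtain a b where ab: "e = {a, b}" "a \<in> V" "b \<in> V" using edges[of e] by blast
    have "v = a \<or> v = b" using e ab(1) by simp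
    then obtain u where u: "e = {v, u}" "u \<in> V" using ab insert_commute[of a b "{}"] by metis
    then show "e \<in> (\<lambda>u. {v, u}) ` nbrs E v V" using e by (intro image_eqI[of _ _ u]) (simp_all add: nbrs_def)
  qed (auto simp: nbrs_def)
  moreover have "inj_on (\<lambda>u. {v, u}) (nbrs E v V)" by (auto simp: inj_on_def doubleton_eq_iff)
  ultimately show ?thesis by (simp add: vertex_degree_def card_image)
qed

definition laplacian :: "('a \<Rightarrow> nat) \<Rightarrow> 'a \<Rightarrow> int" where
  "laplacian \<sigma> v = (\<Sum>u\<in>nbrs E v V. int (\<sigma> v) - int (\<sigma> u))"

text \<open>
  A strictly superharmonic function, with Laplacian as large as desired. It is a concave function of
  the height \<open>h\<close> above the sink: the increments shrink by the factor \<open>N\<close> from one height to the next,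
  so one lower neighbour outweighs all others, of which there are fewer than \<open>N\<close>. Such a script
  serves as a potential that proves termination and as a means to add many grains without changing
  the stabilisation.
\<close>

lemma script_with_large_laplacian:
  fixes k :: nat
  shows "\<exists>\<sigma>\<in>configurations V s. \<forall>v\<in>V - {s}. int k \<le> laplacian \<sigma> v"
proof -
  obtain h :: "'a \<Rightarrow> nat" where h: "h s = 0"
    "\<And>v. v \<in> V - {s} \<Longrightarrow> \<exists>u\<in>V. {v, u} \<in> E \<and> h u < h v"
    using connected_graph_descent[OF connected sink] by blast
  define D N where "D = Max (h ` V)" and "N = card V + 1"
  have hD: "h v \<le> D" if "v \<in> V" for v using that finite_V by (auto simp: D_def)
  have pow: "N ^ (D - h v) \<le> N ^ D" for v by (intro power_increasing) (auto simp: N_def)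
  define \<sigma> where "\<sigma> v = (if v \<in> V then k * (N ^ D - N ^ (D - h v)) else 0)" for v
  have \<sigma>: "int (\<sigma> v) = int k * (int N ^ D - int N ^ (D - h v))" if "v \<in> V" for v
    using that pow[of v] by (simp add: \<sigma>_def of_nat_diff)
  have "int k \<le> laplacian \<sigma> v" if v: "v \<in> V - {s}" for v
  proof -
    obtain u where u: "u \<in> V" "{v, u} \<in> E" "h u < h v" using h(2)[OF v] by blast
    define M where "M = int N ^ (D - h v)"
    have M: "1 \<le> M" by (simp add: M_def N_def)
    have "int N * M = int N ^ (Suc (D - h v))" by (simp add: M_def)
    also have "\<dots> \<le> int N ^ (D - h u)"
      using u hD[of v] v by (intro power_increasing) (auto simp: N_def)
    also have "\<dots> \<le> (\<Sum>w\<in>nbrs E v V. int N ^ (D - h w))"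
      using u finite_V by (intro member_le_sum) (auto simp: nbrs_def)
    \<comment> \<open>The term of the lower neighbour \<open>u\<close> alone is already this large.\<close>
    finally have up: "int N * M \<le> (\<Sum>w\<in>nbrs E v V. int N ^ (D - h w))" .
    have "card (nbrs E v V) \<le> card V"
      using finite_V by (intro card_mono) (auto simp: nbrs_def)
    then have "int (card (nbrs E v V)) * M \<le> int (card V) * M" using M by (intro mult_right_mono) auto
    moreover have "int N * M = int (card V) * M + M" by (simp add: N_def distrib_right)
    ultimately have "1 \<le> (\<Sum>w\<in>nbrs E v V. int N ^ (D - h w)) - int (card (nbrs E v V)) * M"
      using up M by linarith
    then have "int k * 1 \<le> int k * ((\<Sum>w\<in>nbrs E v V. int N ^ (D - h w)) - int (card (nbrs E v V)) * M)"
      by (rule mult_left_mono) simp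
    also have "\<dots> = (\<Sum>w\<in>nbrs E v V. int k * (int N ^ (D - h w) - M))"
      by (simp add: sum_subtractf sum_distrib_left right_diff_distrib)
    also have "\<dots> = laplacian \<sigma> v"
      unfolding laplacian_def
      by (rule sum.cong[OF refl]) (use v in \<open>auto simp: nbrs_def \<sigma> M_def algebra_simps\<close>)
    finally show ?thesis by simp
  qed
  moreover have "\<sigma> \<in> configurations V s"
    using h(1) by (auto simp: configurations_def \<sigma>_def)
  ultimately show ?thesis by blast
qed

lemma int_topple:
  assumes "vertex_degree E v \<le> c v" "u \<in> V - {s}"
  shows "int (topple V E s v c u) = int (c u) +
    (if u = v then - int (card (nbrs E v V)) else if {v, u} \<in> E then 1 else 0)"
  using assms by (auto simp: topple_def vertex_degree_eq of_nat_diff)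

lemma topple_in_configurations: "topple V E s v c \<in> configurations V s"
  by (simp add: configurations_def topple_def)

text \<open>
  The Laplacian is symmetric: up to sign, the value at \<open>v\<close> is the pairing of \<open>\<sigma>\<close> with the change of
  configuration caused by toppling \<open>v\<close>.
\<close>

lemma laplacian_alt:
  assumes "v \<in> V"
  shows "laplacian \<sigma> v =
    - (\<Sum>u\<in>V. int (\<sigma> u) * (if u = v then - int (card (nbrs E v V)) else if {v, u} \<in> E then 1 else 0))"
proof -
  have "(\<Sum>u\<in>V. int (\<sigma> u) * (if u = v then - int (card (nbrs E v V)) else if {v, u} \<in> E then 1 else 0)) =
      (\<Sum>u\<in>V. (if u = v then - int (\<sigma> u) * int (card (nbrs E v V)) else 0) +
        (if {v, u} \<in> E then int (\<sigma> u) else 0))"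
    using edgeD[of v v] by (intro sum.cong) auto
  also have "\<dots> = - int (\<sigma> v) * int (card (nbrs E v V)) + (\<Sum>u\<in>nbrs E v V. int (\<sigma> u))"
    using assms finite_V by (simp add: sum.distrib sum.delta nbrs_def sum.inter_filter[symmetric])
  finally show ?thesis by (simp add: laplacian_def sum_subtractf)
qed

text \<open>
  If the Laplacian of \<open>\<sigma>\<close> is positive off the sink, every toppling lowers the number of grains weighted
  by \<open>\<sigma>\<close>.
\<close>

lemma stabilises:
  assumes "c \<in> configurations V s"
  shows "\<exists>d. (topple_step V E s)\<^sup>*\<^sup>* c d \<and> stable_config V E s d"
proof -
  obtain \<sigma> where \<sigma>: "\<sigma> \<in> configurations V s" and lap: "\<And>v. v \<in> V - {s} \<Longrightarrow> 1 \<le> laplacian \<sigma> v"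
    using script_with_large_laplacian[of 1] by auto
  have \<sigma>s: "\<sigma> s = 0" using \<sigma> by (simp add: configurations_def)
  define \<Phi> where "\<Phi> c = (\<Sum>u\<in>V. \<sigma> u * c u)" for c
  have dec: "\<Phi> (topple V E s v c) < \<Phi> c" if "v \<in> V - {s}" "vertex_degree E v \<le> c v" for v c
  proof -
    have "int (\<Phi> (topple V E s v c)) = (\<Sum>u\<in>V. int (\<sigma> u) * int (c u) + int (\<sigma> u) *
        (if u = v then - int (card (nbrs E v V)) else if {v, u} \<in> E then 1 else 0))"
      unfolding \<Phi>_def of_nat_sum
    proof (rule sum.cong[OF refl])
      fix u assume "u \<in> V"
      then show "int (\<sigma> u * topple V E s v c u) = int (\<sigma> u) * int (c u) + int (\<sigma> u) *
        (if u = v then - int (card (nbrs E v V)) else if {v, u} \<in> E then 1 else 0)"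
        using int_topple[of v c u] that(2) \<sigma>s by (cases "u = s") (simp_all add: distrib_left)
    qed
    also have "\<dots> = int (\<Phi> c) - laplacian \<sigma> v"
      using that(1) by (simp add: laplacian_alt sum.distrib \<Phi>_def)
    finally show ?thesis using lap[OF that(1)] by linarith
  qed
  show ?thesis using assms
  proof (induction "\<Phi> c" arbitrary: c rule: less_induct)
    case less
    show ?case
    proof (cases "stable_config V E s c")
      case False
      then obtain v where v: "v \<in> V - {s}" "vertex_degree E v \<le> c v"
        using less.prems by (auto simp: stable_config_def not_less)
      then have "topple_step V E s c (topple V E s v c)" by (auto simp: topple_step_def)
      moreover obtain d where "(topple_step V E s)\<^sup>*\<^sup>* (topple V E s v c) d" "stable_config V E s d"
        using less.hyps[OF dec[of v c] topple_in_configurations] v by blast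
      ultimately show ?thesis by (meson converse_rtranclp_into_rtranclp)
    qed blast
  qed
qed

lemma topple_unstable_other:
  assumes "w \<in> V - {s}" "w \<noteq> v" "vertex_degree E w \<le> c w"
  shows "vertex_degree E w \<le> topple V E s v c w"
  using assms by (simp add: topple_def)

lemma topple_commute:
  assumes "vertex_degree E v \<le> c v" "vertex_degree E w \<le> c w"
  shows "topple V E s w (topple V E s v c) = topple V E s v (topple V E s w c)"
  using assms by (auto simp: topple_def fun_eq_iff insert_commute)

text \<open>
  Toppling one vertex never takes grains from another, so two unstable vertices can be toppled in
  either order with the same result.
\<close>

lemma confluent_topple_step: "confluentp (topple_step V E s)"
proof (rule strong_confluentp_imp_confluentp, rule strong_confluentpI)
  fix c d d' assume "topple_step V E s c d" "topple_step V E s c d'"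
  then obtain v w where v: "v \<in> V - {s}" "vertex_degree E v \<le> c v" "d = topple V E s v c"
    and w: "w \<in> V - {s}" "vertex_degree E w \<le> c w" "d' = topple V E s w c"
    by (auto simp: topple_step_def)
  show "\<exists>u. (topple_step V E s)\<^sup>*\<^sup>* d u \<and> (topple_step V E s)\<^sup>=\<^sup>= d' u"
  proof (cases "v = w")
    case False
    let ?u = "topple V E s w (topple V E s v c)"
    have "topple_step V E s d ?u"
      using v w topple_unstable_other[of w v c] False by (auto simp: topple_step_def)
    moreover have "topple_step V E s d' ?u"
      using v w topple_unstable_other[of v w c] False topple_commute[of v c w]
      by (auto simp: topple_step_def)
    ultimately show ?thesis by (intro exI[of _ ?u]) auto
  qed (use v w in auto)
qed

lemma stable_no_steps:
  assumes "(topple_step V E s)\<^sup>*\<^sup>* d e" "stable_config V E s d"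
  shows "e = d"
  using assms by (cases rule: converse_rtranclpE) (auto simp: topple_step_def stable_config_def not_less[symmetric])

lemma stabilisation_eqI:
  assumes "(topple_step V E s)\<^sup>*\<^sup>* c d" "stable_config V E s d"
  shows "stabilisation V E s c = d"
  unfolding stabilisation_def
proof (rule the_equality)
  fix e assume e: "(topple_step V E s)\<^sup>*\<^sup>* c e \<and> stable_config V E s e"
  then obtain u where "(topple_step V E s)\<^sup>*\<^sup>* d u" "(topple_step V E s)\<^sup>*\<^sup>* e u"
    using confluentpD[OF confluent_topple_step assms(1)] by blast
  then show "e = d" using assms(2) e stable_no_steps by metis
qed (use assms in auto)

definition no_forbidden_subconfig :: "('a \<Rightarrow> nat) \<Rightarrow> bool" where
  "no_forbidden_subconfig c \<longleftrightarrow>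
    (\<forall>X. X \<subseteq> V - {s} \<longrightarrow> X \<noteq> {} \<longrightarrow> (\<exists>v\<in>X. card (nbrs E v X) \<le> c v))"

lemma nbrs_remove: "nbrs E u X \<subseteq> nbrs E u (X - {v}) \<union> (if {v, u} \<in> E then {v} else {})"
  by (auto simp: nbrs_def insert_commute)

text \<open>
  If \<open>v\<close> lies outside \<open>X\<close>, no vertex of \<open>X\<close> loses grains. If \<open>v\<close> lies in \<open>X\<close>, apply the hypothesis to
  \<open>X - {v}\<close>, unless this is empty: the vertex found there gains a grain exactly when it has \<open>v\<close> as an additional neighbour.
\<close>

lemma no_forbidden_subconfig_topple:
  assumes c: "no_forbidden_subconfig c"
  shows "no_forbidden_subconfig (topple V E s v c)"
  unfolding no_forbidden_subconfig_def
proof (intro allI impI)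
  fix X assume X: "X \<subseteq> V - {s}" "X \<noteq> {}"
  then have finX: "finite X" using finite_V by (auto intro: finite_subset)
  show "\<exists>u\<in>X. card (nbrs E u X) \<le> topple V E s v c u"
  proof (cases "X = {v}")
    case True
    then have "nbrs E v X = {}" using edgeD[of v v] by (auto simp: nbrs_def)
    then show ?thesis using True by simp
  next
    case False
    then have "X - {v} \<subseteq> V - {s}" "X - {v} \<noteq> {}" using X by auto
    then obtain u where u: "u \<in> X - {v}" "card (nbrs E u (X - {v})) \<le> c u"
      using c unfolding no_forbidden_subconfig_def by blast
    have "card (nbrs E u X) \<le> card (nbrs E u (X - {v}) \<union> (if {v, u} \<in> E then {v} else {}))"
      using finX by (intro card_mono nbrs_remove) auto
    also have "\<dots> \<le> card (nbrs E u (X - {v})) + (if {v, u} \<in> E then 1 else 0)"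
      by (rule order_trans[OF card_Un_le]) auto
    also have "\<dots> \<le> topple V E s v c u"
      using u X by (auto simp: topple_def)
    finally show ?thesis using u by auto
  qed
qed

lemma no_forbidden_subconfig_steps:
  assumes "(topple_step V E s)\<^sup>*\<^sup>* c d" "no_forbidden_subconfig c"
  shows "no_forbidden_subconfig d"
  using assms by (induction rule: rtranclp_induct)
    (auto simp: topple_step_def no_forbidden_subconfig_topple)

text \<open>
  A recurrent configuration is reached from one in which every vertex off the sink is unstable. There
  nothing is forbidden, and toppling preserves this.
\<close>

lemma recurrent_imp_no_forbidden_subconfig:
  assumes "recurrent_config V E s c"
  shows "no_forbidden_subconfig c"
proof -
  define d where "d v = (if v \<in> V - {s} then vertex_degree E v else 0)" for v
  have "d \<in> configurations V s" by (simp add: d_def configurations_def)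
  then obtain e where e: "e \<in> configurations V s" "stabilisation V E s (\<lambda>v. d v + e v) = c"
    using assms by (auto simp: recurrent_config_def)
  have "(\<lambda>v. d v + e v) \<in> configurations V s"
    using e(1) \<open>d \<in> configurations V s\<close> by (simp add: configurations_def)
  then have steps: "(topple_step V E s)\<^sup>*\<^sup>* (\<lambda>v. d v + e v) c"
    using stabilises stabilisation_eqI e(2) by metis
  have "no_forbidden_subconfig (\<lambda>v. d v + e v)"
    unfolding no_forbidden_subconfig_def
  proof (intro allI impI)
    fix X assume X: "X \<subseteq> V - {s}" "X \<noteq> {}"
    then obtain v where v: "v \<in> X" by auto
    have "card (nbrs E v X) \<le> card (nbrs E v V)" using X finite_V by (intro card_nbrs_mono) auto
    also have "\<dots> \<le> d v + e v" using v X by (auto simp: d_def vertex_degree_eq)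
    finally show "\<exists>v\<in>X. card (nbrs E v X) \<le> d v + e v" using v by auto
  qed
  then show ?thesis using steps no_forbidden_subconfig_steps by blast
qed

text \<open>
  Firing according to the script \<open>\<sigma>\<close> leads from \<open>b\<close> to \<open>c\<close>; the point is that the firings can be ordered
  into legal topplings. Let \<open>X\<close> be the set where \<open>\<sigma>\<close> is maximal. As \<open>X\<close> is not forbidden in \<open>c\<close>, some
  \<open>v \<in> X\<close> has at least as many grains in \<open>c\<close> as neighbours in \<open>X\<close>, and every neighbour outside \<open>X\<close>
  contributes at least one to the Laplacian at \<open>v\<close>. So \<open>v\<close> is unstable in \<open>b\<close>; topple it and remove one
  firing of \<open>v\<close> from the script.
\<close>

lemma topples_back:
  assumes c: "no_forbidden_subconfig c" "c \<in> configurations V s"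
    and "\<sigma> \<in> configurations V s" "b \<in> configurations V s"
    and "\<And>v. v \<in> V - {s} \<Longrightarrow> int (b v) = int (c v) + laplacian \<sigma> v"
  shows "(topple_step V E s)\<^sup>*\<^sup>* b c"
  using assms(3-)
proof (induction "\<Sum>v\<in>V. \<sigma> v" arbitrary: \<sigma> b rule: less_induct)
  case less
  have \<sigma>0: "\<sigma> v = 0" if "v \<notin> V - {s}" for v
    using less.prems(1) that by (simp add: configurations_def)
  show ?case
  proof (cases "\<forall>v\<in>V. \<sigma> v = 0")
    case True
    have "b v = c v" for v
    proof (cases "v \<in> V - {s}")
      case True
      then have "laplacian \<sigma> v = 0"
        using \<open>\<forall>v\<in>V. \<sigma> v = 0\<close> by (auto simp: laplacian_def nbrs_def)
      then show ?thesis using less.prems(3)[OF True] by simp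
    qed (use c(2) less.prems(2) in \<open>simp add: configurations_def\<close>)
    then have "b = c" by auto
    then show ?thesis by simp
  next
    case False
    define m where "m = Max (\<sigma> ` V)"
    have le_m: "\<sigma> v \<le> m" if "v \<in> V" for v using that finite_V by (auto simp: m_def)
    then have "0 < m" using False by (metis gr0I le_zero_eq)
    define X where "X = {v \<in> V. \<sigma> v = m}"
    have "m \<in> \<sigma> ` V" unfolding m_def using finite_V sink by (intro Max_in) auto
    then have "X \<noteq> {}" by (auto simp: X_def)
    moreover have XV: "X \<subseteq> V - {s}" using \<sigma>0 \<open>0 < m\<close> by (auto simp: X_def)
    ultimately obtain v where v: "v \<in> X" "card (nbrs E v X) \<le> c v"
      using c(1) unfolding no_forbidden_subconfig_def by blast
    then have vV: "v \<in> V - {s}" using XV by auto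
    have "int (card (nbrs E v V)) - int (card (nbrs E v X)) = (\<Sum>u\<in>nbrs E v V. if u \<in> X then 0 else 1)"
    proof -
      have "card (nbrs E v V) = card (nbrs E v X) + card (nbrs E v (V - X))"
        using card_nbrs_Un[of X "V - X" E v] XV finite_V
        by (metis Diff_disjoint Diff_partition Diff_subset dual_order.trans finite_Diff finite_subset)
      moreover have "(\<Sum>u\<in>nbrs E v V. if u \<in> X then 0 else 1 :: int) = int (card (nbrs E v (V - X)))"
      proof -
        have "(\<Sum>u\<in>nbrs E v V. if u \<in> X then 0 else 1 :: int) = (\<Sum>u\<in>nbrs E v (V - X). 1)"
          using finite_V by (intro sum.mono_neutral_cong_right) (auto simp: nbrs_def)
        then show ?thesis by simp
      qed
      ultimately show ?thesis by simp
    qed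
    also have "\<dots> \<le> laplacian \<sigma> v"
      unfolding laplacian_def
    proof (rule sum_mono)
      fix u assume "u \<in> nbrs E v V"
      then have "u \<in> V" by (simp add: nbrs_def)
      then show "(if u \<in> X then 0 else 1) \<le> int (\<sigma> v) - int (\<sigma> u)"
        using le_m[of u] v(1) by (auto simp: X_def)
    qed
    finally have unstable: "vertex_degree E v \<le> b v"
      using less.prems(3)[OF vV] v(2) unfolding vertex_degree_eq by linarith
    define \<sigma>' where "\<sigma>' = \<sigma>(v := \<sigma> v - 1)"
    have \<sigma>v: "0 < \<sigma> v" using v \<open>0 < m\<close> by (simp add: X_def)
    have "(topple_step V E s)\<^sup>*\<^sup>* (topple V E s v b) c"
    proof (rule less.hyps)
      show "(\<Sum>v\<in>V. \<sigma>' v) < (\<Sum>v\<in>V. \<sigma> v)"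
        using finite_V vV \<sigma>v by (intro sum_strict_mono_ex1) (auto simp: \<sigma>'_def)
      show "\<sigma>' \<in> configurations V s"
        using less.prems(1) vV by (auto simp: configurations_def \<sigma>'_def)
      show "topple V E s v b \<in> configurations V s" by (rule topple_in_configurations)
      fix u assume u: "u \<in> V - {s}"
      have "laplacian \<sigma>' u - laplacian \<sigma> u = (\<Sum>w\<in>nbrs E u V. (if w = v then 1 else 0) - (if u = v then 1 else 0))"
        unfolding laplacian_def sum_subtractf[symmetric]
        using \<sigma>v by (intro sum.cong) (auto simp: \<sigma>'_def of_nat_diff)
      also have "\<dots> = (if {v, u} \<in> E then 1 else 0) - (if u = v then int (card (nbrs E v V)) else 0)"
        using finite_V vV by (auto simp: sum_subtractf sum.delta nbrs_def insert_commute)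
      finally have "laplacian \<sigma>' u = laplacian \<sigma> u +
          (if u = v then - int (card (nbrs E v V)) else if {v, u} \<in> E then 1 else 0)"
        using edgeD[of v v] by (auto split: if_splits)
      then show "int (topple V E s v b u) = int (c u) + laplacian \<sigma>' u"
        using int_topple[of v b u] unstable u less.prems(3)[OF u] by simp
    qed
    moreover have "topple_step V E s b (topple V E s v b)"
      using unstable vV by (auto simp: topple_step_def)
    ultimately show ?thesis by (metis converse_rtranclp_into_rtranclp)
  qed
qed

text \<open>
  Dhar's criterion. For the converse direction, given \<open>d\<close>, add to \<open>c\<close> the Laplacian of a script so large
  that the sum dominates \<open>d\<close>: that sum is of the form \<open>d + e\<close>, and it topples back to \<open>c\<close>.
\<close>

theorem recurrent_config_iff:
  "recurrent_config V E s c \<longleftrightarrow> stable_config V E s c \<and> no_forbidden_subconfig c"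
proof
  assume "recurrent_config V E s c"
  then show "stable_config V E s c \<and> no_forbidden_subconfig c"
    using recurrent_imp_no_forbidden_subconfig by (auto simp: recurrent_config_def)
next
  assume c: "stable_config V E s c \<and> no_forbidden_subconfig c"
  have "\<exists>e\<in>configurations V s. stabilisation V E s (\<lambda>v. d v + e v) = c"
    if d: "d \<in> configurations V s" for d
  proof -
    obtain \<sigma> where \<sigma>: "\<sigma> \<in> configurations V s"
      and lap: "\<And>v. v \<in> V - {s} \<Longrightarrow> int (\<Sum>u\<in>V. d u) \<le> laplacian \<sigma> v"
      using script_with_large_laplacian[of "\<Sum>u\<in>V. d u"] by auto
    have large: "int (d v) \<le> laplacian \<sigma> v" if "v \<in> V - {s}" for v
    proof -
      have "d v \<le> (\<Sum>u\<in>V. d u)" using that finite_V by (intro member_le_sum) auto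
      then show ?thesis using lap[OF that] by linarith
    qed
    define e where "e v = (if v \<in> V - {s} then nat (int (c v) + laplacian \<sigma> v - int (d v)) else 0)" for v
    have e: "e \<in> configurations V s" by (simp add: e_def configurations_def)
    have "(topple_step V E s)\<^sup>*\<^sup>* (\<lambda>v. d v + e v) c"
    proof (rule topples_back[OF _ _ \<sigma>])
      show "no_forbidden_subconfig c" "c \<in> configurations V s"
        using c by (auto simp: stable_config_def)
      show "(\<lambda>v. d v + e v) \<in> configurations V s" using d e by (simp add: configurations_def)
      show "int (d v + e v) = int (c v) + laplacian \<sigma> v" if "v \<in> V - {s}" for v
        using large[OF that] that by (simp add: e_def)
    qed
    then show ?thesis using stabilisation_eqI c e by blast
  qed
  then show "recurrent_config V E s c" using c by (simp add: recurrent_config_def)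
qed

lemma card_recurrent_eq_card_allowed_configs:
  "card {c. recurrent_config V E s c} = card (allowed_configs E (V - {s}) {s})"
proof (rule bij_betw_same_card)
  have V: "V - {s} \<union> {s} = V" using sink by auto
  let ?zero = "\<lambda>c v. if v \<in> V - {s} then c v else 0"
  show "bij_betw (\<lambda>c. restrict c (V - {s})) {c. recurrent_config V E s c}
    (allowed_configs E (V - {s}) {s})"
  proof (rule bij_betw_byWitness[where f' = ?zero])
    show "\<forall>c\<in>{c. recurrent_config V E s c}. ?zero (restrict c (V - {s})) = c"
      by (auto simp: recurrent_config_def stable_config_def configurations_def fun_eq_iff)
    show "\<forall>c\<in>allowed_configs E (V - {s}) {s}. restrict (?zero c) (V - {s}) = c"
    proof
      fix c assume "c \<in> allowed_configs E (V - {s}) {s}"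
      then have "c \<in> extensional (V - {s})" by (simp add: allowed_configs_def)
      then show "restrict (?zero c) (V - {s}) = c"
        by (auto simp: fun_eq_iff restrict_def extensional_def)
    qed
    show "(\<lambda>c. restrict c (V - {s})) ` {c. recurrent_config V E s c} \<subseteq> allowed_configs E (V - {s}) {s}"
    proof (rule image_subsetI)
      fix c assume "c \<in> {c. recurrent_config V E s c}"
      then have c: "stable_config V E s c" "no_forbidden_subconfig c"
        by (simp_all add: recurrent_config_iff)
      have "\<exists>v\<in>X. card (nbrs E v X) \<le> restrict c (V - {s}) v" if X: "X \<subseteq> V - {s}" "X \<noteq> {}" for X
      proof -
        obtain v where "v \<in> X" "card (nbrs E v X) \<le> c v"
          using c(2) X unfolding no_forbidden_subconfig_def by blast
        then show ?thesis using X(1) by (intro bexI[of _ v]) auto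
      qed
      then show "restrict c (V - {s}) \<in> allowed_configs E (V - {s}) {s}"
        using c(1) unfolding allowed_configs_def V
        by (simp add: stable_config_def vertex_degree_eq)
    qed
    show "?zero ` allowed_configs E (V - {s}) {s} \<subseteq> {c. recurrent_config V E s c}"
    proof (rule image_subsetI)
      fix c assume c: "c \<in> allowed_configs E (V - {s}) {s}"
      have "stable_config V E s (?zero c)"
        using allowed_configs_less[OF c] V
        by (simp add: stable_config_def configurations_def vertex_degree_eq)
      moreover have "no_forbidden_subconfig (?zero c)"
        unfolding no_forbidden_subconfig_def
      proof (intro allI impI)
        fix X assume X: "X \<subseteq> V - {s}" "X \<noteq> {}"
        obtain v where "v \<in> X" "card (nbrs E v X) \<le> c v" by (rule allowed_configs_ge[OF c X])
        then show "\<exists>v\<in>X. card (nbrs E v X) \<le> ?zero c v" using X(1) by (intro bexI[of _ v]) auto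
      qed
      ultimately show "?zero c \<in> {c. recurrent_config V E s c}" by (simp add: recurrent_config_iff)
    qed
  qed
qed

theorem card_recurrent_eq_card_spanning_trees:
  "card {c. recurrent_config V E s c} = card (spanning_trees V E)"
proof -
  have "card (allowed_configs E (V - {s}) {s}) = card (rooted_forests E (V - {s}) {s})"
    using finite_V by (intro card_allowed_configs_eq_card_rooted_forests) auto
  then show ?thesis
    using card_spanning_trees_eq_card_rooted_forests[OF sink edges]
    by (simp add: card_recurrent_eq_card_allowed_configs)
qed

end

section \<open>Rooted forests of the complete split graph\<close>

lemma sum_Pow_insert:
  fixes g :: "'a set \<Rightarrow> 'b :: comm_monoid_add"
  assumes "finite A" "x \<notin> A"
  shows "(\<Sum>X\<in>Pow (insert x A). g X) = (\<Sum>X\<in>Pow A. g X) + (\<Sum>X\<in>Pow A. g (insert x X))"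
proof -
  have "inj_on (insert x) (Pow A)"
    using assms(2) by (intro inj_onI) (metis PowD insert_ident subsetD)
  then have "(\<Sum>X\<in>insert x ` Pow A. g X) = (\<Sum>X\<in>Pow A. g (insert x X))"
    by (simp add: sum.reindex)
  moreover have "Pow A \<inter> insert x ` Pow A = {}" using assms(2) by auto
  ultimately show ?thesis
    using assms(1) by (simp add: Pow_insert sum.union_disjoint)
qed

lemma binomial_sum_Pow:
  fixes x y :: "'b :: comm_ring_1"
  assumes "finite A"
  shows "(\<Sum>X\<in>Pow A. x ^ card X * y ^ card (A - X)) = (x + y) ^ card A"
  using prod_add[OF assms, of "\<lambda>_. x" "\<lambda>_. y"] by simp

text \<open>
  This is \<open>x\<close> times the derivative of the binomial theorem with respect to \<open>x\<close>, multiplied by \<open>x + y\<close>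
  to avoid the exponent \<open>card A - 1\<close>.
\<close>

lemma weighted_binomial_sum_Pow:
  fixes x y :: "'b :: comm_ring_1"
  assumes "finite A"
  shows "(x + y) * (\<Sum>X\<in>Pow A. of_nat (card X) * (x ^ card X * y ^ card (A - X))) =
    of_nat (card A) * x * (x + y) ^ card A"
  using assms
proof (induction A rule: finite_induct)
  case empty
  then show ?case by simp
next
  case (insert z A)
  let ?S = "\<lambda>A. \<Sum>X\<in>Pow A. of_nat (card X) * (x ^ card X * y ^ card (A - X))"
  have without: "card (insert z A - X) = Suc (card (A - X))" "card (insert z X) = Suc (card X)"
      "insert z A - insert z X = A - X" if "X \<in> Pow A" for X
  proof -
    have "finite X" "z \<notin> X" using that insert.hyps by (auto dest: finite_subset)
    then show "card (insert z A - X) = Suc (card (A - X))" "card (insert z X) = Suc (card X)"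
      "insert z A - insert z X = A - X"
      using insert.hyps by (auto simp: insert_Diff_if)
  qed
  have "?S (insert z A) = (\<Sum>X\<in>Pow A. y * (of_nat (card X) * (x ^ card X * y ^ card (A - X)))) +
      (\<Sum>X\<in>Pow A. x * (of_nat (card X) * (x ^ card X * y ^ card (A - X))) +
         x * (x ^ card X * y ^ card (A - X)))"
    unfolding sum_Pow_insert[OF insert.hyps]
    by (intro arg_cong2[where f = "(+)"] sum.cong refl;
        simp only: without power_Suc of_nat_Suc mult_1_left; simp only: algebra_simps mult_1_left)
  also have "\<dots> = (x + y) * ?S A + x * (x + y) ^ card A"
    by (simp add: sum.distrib sum_distrib_left[symmetric] binomial_sum_Pow insert.hyps distrib_right)
  finally have "?S (insert z A) = of_nat (card A) * x * (x + y) ^ card A + x * (x + y) ^ card A"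
    unfolding insert.IH .
  then show ?case using insert.hyps by (simp add: algebra_simps)
qed

lemma sum_Pow_Un:
  assumes "finite A" "finite B" "A \<inter> B = {}"
  shows "(\<Sum>X\<in>Pow (A \<union> B). g X) = (\<Sum>X\<in>Pow A. \<Sum>Y\<in>Pow B. g (X \<union> Y))"
proof -
  have "(\<Sum>X\<in>Pow A. \<Sum>Y\<in>Pow B. g (X \<union> Y)) = (\<Sum>(X, Y)\<in>Pow A \<times> Pow B. g (X \<union> Y))"
    by (simp add: sum.cartesian_product)
  also have "\<dots> = (\<Sum>X\<in>Pow (A \<union> B). g X)"
    using assms(3)
    by (intro sum.reindex_bij_witness[where i = "\<lambda>Z. (Z \<inter> A, Z \<inter> B)" and j = "\<lambda>(X, Y). X \<union> Y"])
      (auto simp: Int_Un_distrib2 Int_Un_distrib[symmetric] Int_absorb2)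
  finally show ?thesis by simp
qed

text \<open>
  The summation over all first layers for the split graph. The last factor is a combination of
  products of a function of \<open>card X\<close> and a function of \<open>card Y\<close>, so the double sum falls apart into
  plain and weighted binomial sums.
\<close>

lemma split_forest_identity:
  fixes A B :: "'a set" and p x :: int
  assumes fin: "finite A" "finite B"
  defines "a \<equiv> int (card A)" and "b \<equiv> int (card B)"
  defines "t \<equiv> a + b"
  shows "(x + t) * (p + a) *
    (\<Sum>X\<in>Pow A. \<Sum>Y\<in>Pow B. (x ^ card X * p ^ card Y) *
       (a ^ card (B - Y) * t ^ card (A - X) *
         (int (card X) * (t - int (card Y)) + int (card Y) * a))) =
    a * t * ((p + a) ^ card B * (x + t) ^ card A * (x * (p + a) + b * p))"
  (is "_ * ?W = _")
proof -
  define S0 S1 T0 T1 where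
    "S0 = (\<Sum>X\<in>Pow A. x ^ card X * t ^ card (A - X))" and
    "S1 = (\<Sum>X\<in>Pow A. int (card X) * (x ^ card X * t ^ card (A - X)))" and
    "T0 = (\<Sum>Y\<in>Pow B. p ^ card Y * a ^ card (B - Y))" and
    "T1 = (\<Sum>Y\<in>Pow B. int (card Y) * (p ^ card Y * a ^ card (B - Y)))"
  have S0: "S0 = (x + t) ^ card A" and T0: "T0 = (p + a) ^ card B"
    using fin by (simp_all add: S0_def T0_def binomial_sum_Pow)
  have S1: "(x + t) * S1 = a * x * (x + t) ^ card A" and T1: "(p + a) * T1 = b * p * (p + a) ^ card B"
    using fin by (simp_all add: S1_def T1_def weighted_binomial_sum_Pow a_def b_def)
  have "(\<Sum>X\<in>Pow A. \<Sum>Y\<in>Pow B. (x ^ card X * p ^ card Y) *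
       (a ^ card (B - Y) * t ^ card (A - X) *
         (int (card X) * (t - int (card Y)) + int (card Y) * a))) =
    (\<Sum>X\<in>Pow A. \<Sum>Y\<in>Pow B.
       t * ((int (card X) * (x ^ card X * t ^ card (A - X))) * (p ^ card Y * a ^ card (B - Y)))
     - (int (card X) * (x ^ card X * t ^ card (A - X))) * (int (card Y) * (p ^ card Y * a ^ card (B - Y)))
     + a * ((x ^ card X * t ^ card (A - X)) * (int (card Y) * (p ^ card Y * a ^ card (B - Y)))))"
    by (intro sum.cong refl) (simp add: algebra_simps)
  also have "\<dots> = t * (S1 * T0) - S1 * T1 + a * (S0 * T1)"
    unfolding S0_def S1_def T0_def T1_def
    by (simp only: sum.distrib sum_subtractf sum_distrib_left[symmetric] sum_distrib_right[symmetric])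
  finally have W: "?W = t * (S1 * T0) - S1 * T1 + a * (S0 * T1)" .
  have "(x + t) * (p + a) * ?W =
    t * ((x + t) * S1) * ((p + a) * T0) - ((x + t) * S1) * ((p + a) * T1) + a * ((x + t) * S0) * ((p + a) * T1)"
    unfolding W by (simp add: algebra_simps)
  also have "\<dots> = a * t * ((p + a) ^ card B * (x + t) ^ card A * (x * (p + a) + b * p))"
    unfolding S0 S1 T0 T1 by (simp add: t_def algebra_simps)
  finally show ?thesis .
qed

lemma rooted_forests_no_inner_edges:
  assumes "\<And>u v. u \<in> U \<Longrightarrow> v \<in> U \<Longrightarrow> {u, v} \<notin> E"
  shows "rooted_forests E U L = PiE U (\<lambda>v. nbrs E v L)"
proof -
  have nbrs_L: "nbrs E v (U \<union> L) = nbrs E v L" "nbrs E v L \<inter> U = {}" if "v \<in> U" for v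
    using assms that by (auto simp: nbrs_def)
  show ?thesis
  proof (intro set_eqI iffI)
    fix f assume f: "f \<in> PiE U (\<lambda>v. nbrs E v L)"
    have "f v \<notin> U" if "v \<in> U" for v using PiE_mem[OF f that] nbrs_L(2)[OF that] by blast
    then show "f \<in> rooted_forests E U L"
      using f by (simp add: rooted_forests_def PiE_iff nbrs_L(1))
  qed (simp add: rooted_forests_def PiE_iff nbrs_L(1))
qed

lemma split_edges_iff:
  "{u, v} \<in> split_edges m n \<longleftrightarrow> u \<noteq> v \<and> u \<in> split_verts m n \<and> v \<in> split_verts m n \<and>
     (u \<in> range Clique \<or> v \<in> range Clique)"
  by (cases u; cases v) (auto simp: split_edges_def split_verts_def doubleton_eq_iff)

lemma nbrs_split_Clique:
  assumes "v \<in> Clique ` {..<m}" "L \<subseteq> split_verts m n" "v \<notin> L"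
  shows "nbrs (split_edges m n) v L = L"
  using assms by (auto simp: nbrs_def split_edges_iff split_verts_def)

lemma nbrs_split_Indep:
  assumes "v \<in> Indep ` {..<n}" "P \<subseteq> Clique ` {..<m}" "Q \<subseteq> Indep ` {..<n}"
  shows "nbrs (split_edges m n) v (P \<union> Q) = P"
  using assms by (auto simp: nbrs_def split_edges_iff split_verts_def)

text \<open>
  Here \<open>A\<close> and \<open>B\<close> are the clique and independent vertices to be attached, and \<open>P\<close> and \<open>Q\<close> the clique and
  independent roots. The closed form is the determinant of the Laplacian restricted to \<open>A \<union> B\<close>, in
  which \<open>d\<close> is the degree of a vertex of \<open>B\<close> and \<open>t\<close> is one more than the degree, inside \<open>A \<union> B \<union> P \<union> Q\<close>,
  of a vertex of \<open>A\<close>; multiplying by \<open>d * t\<close> avoids negative exponents.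
  
  The induction works because, whatever the first layer \<open>X \<union> Y\<close> is, the smaller problem has the same
  values \<open>card A\<close> and \<open>card A + card B\<close> in place of \<open>d\<close> and \<open>t\<close>. They can be cancelled only if \<open>A\<close> is
  nonempty; if it is empty, all vertices are attached directly to \<open>P\<close>.
\<close>

theorem card_rooted_forests_split:
  fixes m n :: nat and d t :: int
  assumes "A \<subseteq> Clique ` {..<m}" "P \<subseteq> Clique ` {..<m}" "A \<inter> P = {}"
    and "B \<subseteq> Indep ` {..<n}" "Q \<subseteq> Indep ` {..<n}" "B \<inter> Q = {}"
    and "d = int (card A + card P)"
    and "t = int (card A + card B + card P + card Q)"
  shows "d * t * int (card (rooted_forests (split_edges m n) (A \<union> B) (P \<union> Q))) =
    d ^ card B * t ^ card A * (int (card P + card Q) * d + int (card B) * int (card P))"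
  using assms
proof (induction "card (A \<union> B)" arbitrary: A B P Q d t rule: less_induct)
  case less
  let ?E = "split_edges m n"
  let ?N = "\<lambda>U L. int (card (rooted_forests ?E U L))"
  let ?p = "int (card P)" and ?x = "int (card P + card Q)"
  let ?a = "int (card A)" and ?b = "int (card B)"
  note sub = less.prems(1-6)
  have d: "d = ?p + ?a" and t: "t = ?x + (?a + ?b)" using less.prems(7,8) by simp_all
  have fin: "finite A" "finite B" "finite P" "finite Q"
    using sub by (auto intro: finite_subset)
  have CI: "C \<inter> I = {}" if "C \<subseteq> Clique ` {..<m}" "I \<subseteq> Indep ` {..<n}" for C I
    using that by auto
  have disj: "(A \<union> B) \<inter> (P \<union> Q) = {}" using sub by auto
  have cN: "card (nbrs ?E v (P \<union> Q)) = card P + card Q" if "v \<in> A" for v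
  proof -
    have "nbrs ?E v (P \<union> Q) = P \<union> Q"
      using sub that disj by (intro nbrs_split_Clique) (auto simp: split_verts_def)
    then show ?thesis using fin CI[OF sub(2,5)] by (simp add: card_Un_disjoint)
  qed
  have iN: "card (nbrs ?E v (P \<union> Q)) = card P" if "v \<in> B" for v
    using sub that by (subst nbrs_split_Indep) auto
  show ?case
  proof (cases "A = {}")
    case True
    have "rooted_forests ?E (A \<union> B) (P \<union> Q) = PiE B (\<lambda>v. nbrs ?E v (P \<union> Q))"
      unfolding True Un_empty_left
      using sub(4) by (intro rooted_forests_no_inner_edges) (auto simp: split_edges_iff)
    then have "?N (A \<union> B) (P \<union> Q) = ?p ^ card B"
      using fin iN by (simp add: card_PiE)
    then show ?thesis using True by (simp add: d t algebra_simps)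
  next
    case False
    then have ne: "A \<union> B \<noteq> {}" and a0: "?a \<noteq> 0" and ab0: "?a + ?b \<noteq> 0"
      using fin by (auto simp: add_nonneg_eq_0_iff)
    have summand: "?a * (?a + ?b) * ?N (A \<union> B - (X \<union> Y)) (X \<union> Y) =
        ?a ^ card (B - Y) * (?a + ?b) ^ card (A - X) *
          (int (card X) * ((?a + ?b) - int (card Y)) + int (card Y) * ?a)"
      if X: "X \<in> Pow A" and Y: "Y \<in> Pow B" for X Y
    proof (cases "X \<union> Y = {}")
      case True
      then show ?thesis using rooted_forests_no_roots[OF _ ne] fin by simp
    next
      case False
      have finXY: "finite X" "finite Y" using X Y fin by (auto intro: finite_subset)
      have cA: "card A = card (A - X) + card X" and cB: "card B = card (B - Y) + card Y"
        using X Y fin finXY by (simp_all add: card_Diff_subset card_mono)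
      have split: "A \<union> B - (X \<union> Y) = (A - X) \<union> (B - Y)" using X Y sub by blast
      have "card ((A - X) \<union> (B - Y)) < card (A \<union> B)"
        unfolding split[symmetric] using False X Y fin by (intro psubset_card_mono) auto
      then have "int (card (A - X) + card X) * int (card (A - X) + card (B - Y) + card X + card Y) *
          ?N ((A - X) \<union> (B - Y)) (X \<union> Y) =
        int (card (A - X) + card X) ^ card (B - Y) *
        int (card (A - X) + card (B - Y) + card X + card Y) ^ card (A - X) *
        (int (card X + card Y) * int (card (A - X) + card X) + int (card (B - Y)) * int (card X))"
        by (rule less.hyps) (use X Y sub in auto)
      moreover have eqs: "int (card (A - X) + card X) = ?a"
        "int (card (A - X) + card (B - Y) + card X + card Y) = ?a + ?b"
        "int (card (B - Y)) = ?b - int (card Y)"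
        using cA cB by simp_all
      ultimately show ?thesis unfolding eqs split by (simp add: algebra_simps)
    qed
    have weight: "(\<Prod>v\<in>X \<union> Y. card (nbrs ?E v (P \<union> Q))) = (card P + card Q) ^ card X * card P ^ card Y"
      if X: "X \<in> Pow A" and Y: "Y \<in> Pow B" for X Y
    proof -
      have finXY: "finite X" "finite Y" using X Y fin by (auto intro: finite_subset)
      have "X \<inter> Y = {}" using X Y CI[OF sub(1,4)] by blast
      then have "(\<Prod>v\<in>X \<union> Y. card (nbrs ?E v (P \<union> Q))) =
          (\<Prod>v\<in>X. card (nbrs ?E v (P \<union> Q))) * (\<Prod>v\<in>Y. card (nbrs ?E v (P \<union> Q)))"
        using finXY by (intro prod.union_disjoint) auto
      also have "\<dots> = (\<Prod>v\<in>X. card P + card Q) * (\<Prod>v\<in>Y. card P)"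
        using X Y cN iN by (intro arg_cong2[where f = "(*)"] prod.cong) auto
      finally show ?thesis by simp
    qed
    have "?N (A \<union> B) (P \<union> Q) = (\<Sum>Z\<in>Pow (A \<union> B) - {{}}.
        int (\<Prod>v\<in>Z. card (nbrs ?E v (P \<union> Q))) * ?N (A \<union> B - Z) Z)"
      using card_rooted_forests_rec[OF _ _ ne disj] fin by simp
    \<comment> \<open>The empty layer contributes nothing, as there are no forests without roots.\<close>
    also have "\<dots> = (\<Sum>Z\<in>Pow (A \<union> B). int (\<Prod>v\<in>Z. card (nbrs ?E v (P \<union> Q))) * ?N (A \<union> B - Z) Z)"
      using fin rooted_forests_no_roots[OF _ ne] by (intro sum.mono_neutral_left) auto
    also have "\<dots> = (\<Sum>X\<in>Pow A. \<Sum>Y\<in>Pow B.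
        int (\<Prod>v\<in>X \<union> Y. card (nbrs ?E v (P \<union> Q))) * ?N (A \<union> B - (X \<union> Y)) (X \<union> Y))"
      by (rule sum_Pow_Un[OF fin(1,2) CI[OF sub(1,4)]])
    also have "\<dots> = (\<Sum>X\<in>Pow A. \<Sum>Y\<in>Pow B. (?x ^ card X * ?p ^ card Y) * ?N (A \<union> B - (X \<union> Y)) (X \<union> Y))"
      by (intro sum.cong refl) (simp add: weight)
    finally have N: "?N (A \<union> B) (P \<union> Q) = \<dots>" .
    have "?a * (?a + ?b) * ?N (A \<union> B) (P \<union> Q) = (\<Sum>X\<in>Pow A. \<Sum>Y\<in>Pow B. (?x ^ card X * ?p ^ card Y) *
        (?a * (?a + ?b) * ?N (A \<union> B - (X \<union> Y)) (X \<union> Y)))"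
      unfolding N sum_distrib_left by (intro sum.cong refl) (simp add: algebra_simps)
    also have "\<dots> = (\<Sum>X\<in>Pow A. \<Sum>Y\<in>Pow B. (?x ^ card X * ?p ^ card Y) *
        (?a ^ card (B - Y) * (?a + ?b) ^ card (A - X) *
          (int (card X) * ((?a + ?b) - int (card Y)) + int (card Y) * ?a)))"
      by (intro sum.cong refl) (simp only: summand)
    finally have "?a * (?a + ?b) * (d * t * ?N (A \<union> B) (P \<union> Q)) = t * d * \<dots>"
      by (simp only: mult.commute mult.left_commute)
    also have "\<dots> = ?a * (?a + ?b) * (d ^ card B * t ^ card A * (?x * d + ?b * ?p))"
      unfolding d t by (rule split_forest_identity[OF fin(1,2)])
    finally show ?thesis using a0 ab0 by simp
  qed
qed

lemma sandpile_graph_split: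
  assumes "m \<ge> 1" "s \<in> split_verts m n"
  shows "sandpile_graph (split_verts m n) (split_edges m n) s"
proof
  show "finite (split_verts m n)" by (simp add: split_verts_def)
  show "s \<in> split_verts m n" by fact
  show "\<exists>u v. e = {u, v} \<and> u \<noteq> v \<and> u \<in> split_verts m n \<and> v \<in> split_verts m n"
    if e: "e \<in> split_edges m n" for e
  proof -
    obtain u v where "e = {u, v}" using e by (auto simp: split_edges_def)
    then show ?thesis using e by (intro exI[of _ u] exI[of _ v]) (simp add: split_edges_iff)
  qed
  show "connected_graph (split_verts m n) (split_edges m n)"
  proof (rule connected_graph_if_descent[where s = "Clique 0" and h = "\<lambda>v. if v = Clique 0 then 0 else 1"])
    show "Clique 0 \<in> split_verts m n" using assms(1) by (auto simp: split_verts_def)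
    then show "\<exists>u\<in>split_verts m n. {v, u} \<in> split_edges m n \<and>
        (if u = Clique 0 then 0 else 1) < (if v = Clique 0 then 0 else 1 :: nat)"
      if "v \<in> split_verts m n - {Clique 0}" for v
      using that by (intro bexI[of _ "Clique 0"]) (auto simp: split_edges_iff)
  qed
qed

text \<open>
  Root the trees at the clique vertex \<open>Clique 0\<close>: then \<open>d = m\<close> and \<open>t = m + n\<close>, and there are no
  independent roots.
\<close>

lemma card_spanning_trees_split:
  fixes m n :: nat
  assumes "m \<ge> 1" "n \<ge> 1"
  shows "card (spanning_trees (split_verts m n) (split_edges m n)) = (m + n) ^ (m - 1) * m ^ (n - 1)"
proof -
  let ?V = "split_verts m n" and ?E = "split_edges m n"
  let ?A = "Clique ` {..<m} - {Clique 0}" and ?B = "Indep ` {..<n}" and ?s = "Clique 0"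
  interpret sandpile_graph ?V ?E ?s
    using assms by (intro sandpile_graph_split) (auto simp: split_verts_def)
  have cA: "card ?A = m - 1" and cB: "card ?B = n"
    using assms by (auto simp: card_Diff_subset card_image inj_on_def)
  have "?V - {?s} = ?A \<union> ?B" by (auto simp: split_verts_def)
  then have st: "card (spanning_trees ?V ?E) = card (rooted_forests ?E (?A \<union> ?B) ({?s} \<union> {}))"
    using card_spanning_trees_eq_card_rooted_forests[OF sink edges] by simp
  have "int m * int (m + n) * int (card (rooted_forests ?E (?A \<union> ?B) ({?s} \<union> {}))) =
      int m ^ n * int (m + n) ^ (m - 1) * (int m + int n)"
    using card_rooted_forests_split[of ?A m "{?s}" ?B n "{}"] assms(1) unfolding cA cB
    by (simp add: of_nat_diff add.commute)
  moreover have "int m ^ n = int m * int m ^ (n - 1)"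
    using assms(2) by (cases n) auto
  ultimately have "int (m * (m + n)) * int (card (spanning_trees ?V ?E)) =
      int (m * (m + n)) * int ((m + n) ^ (m - 1) * m ^ (n - 1))"
    unfolding st by (simp add: algebra_simps)
  then show ?thesis using assms by (simp only: mult_cancel_left of_nat_eq_iff of_nat_eq_0_iff) auto
qed

theorem corollary3p9:
  fixes m n :: nat
  assumes "m \<ge> 1" and "n \<ge> 1"
  shows "card (spanning_trees (split_verts m n) (split_edges m n)) = (m + n) ^ (m - 1) * m ^ (n - 1) \<and>
    (\<forall>s \<in> split_verts m n.
       card {c. recurrent_config (split_verts m n) (split_edges m n) s c} =
         (m + n) ^ (m - 1) * m ^ (n - 1))"
  using card_spanning_trees_split[OF assms]
    sandpile_graph.card_recurrent_eq_card_spanning_trees[OF sandpile_graph_split[OF assms(1)]]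
  by simp

end
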